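(* Let $(f_j)_{j\in\mathbb{N}}$ be a sequence of nonnegative functions $f_j\in L^p$ on a measure space. (i) If $p\in[2,\infty)$, then for every $n\in\mathbb{N}$ $$\Bigl\|\sum_{j=1}^n f_j\Bigr\|_p^p\le \sum_{j=1}^n\|f_j\|_p^p+C_p\Bigl\|\sum_{j=1}^n f_j\Bigr\|_p^{p-2}\Bigl\|\sum_{1\le i<j\le n}f_if_j\Bigr\|_{p/2},$$ where $C_p=\max\left\{p,\frac{2^p-2}{2^{p-2}}\right\}$. (ii) If $p\in[1,2]$, then for every $n\in\mathbb{N}$ $$\Bigl\|\sum_{j=1}^n f_j\Bigr\|_p^p\ge \sum_{j=1}^n\|f_j\|_p^p+\frac{2^p-2}{2^{p-2}}\,\frac{\bigl\|\sum_{1\le i<j\le n}f_if_j\bigr\|_{p/2}}{\bigl\|\sum_{j=1}^n f_j\bigr\|_p^{2-p}},$$ provided that $\sum_{j=1}^n f_j\neq 0$ almost everywhere.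
   Context: The underlying measure space is arbitrary and functions are measurable. For a real $r>0$ and a measurable function $h$, $\|h\|_r=\left(\int|h|^r\right)^{1/r}$ (also when $0<r<1$). *)

theory Defs
  imports "HOL-Analysis.Analysis"
begin

definition Lp_space :: "'a measure \<Rightarrow> real \<Rightarrow> ('a \<Rightarrow> real) set" where
  "Lp_space M r =
     {h. h \<in> borel_measurable M \<and> integrable M (\<lambda>x. \<bar>h x\<bar> powr r)}"

text \<open>
  The quantity below is meant for every real \<open>r > 0\<close>; it is only a quasi-norm for \<open>r < 1\<close>.
  The Bochner integral is 0 on non-integrable functions, so it is the true (finite) value
  only for \<open>h\<close> in \<open>Lp_space M r\<close>. Finite sums of elements of \<open>L\<^sup>p\<close> lie in
  \<open>L\<^sup>p\<close>, and their pairwise products lie in \<open>L\<close> of exponent \<open>p / 2\<close> by Cauchy--Schwarz.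
\<close>

definition Lp_norm :: "'a measure \<Rightarrow> real \<Rightarrow> ('a \<Rightarrow> real) \<Rightarrow> real" where
  "Lp_norm M r h = (\<integral>x. \<bar>h x\<bar> powr r \<partial>M) powr (1 / r)"

end

theory Submission
  imports Defs
begin

text \<open>
  Write \<open>S\<close> for the sum of the functions and \<open>Q\<close> for the sum of their pairwise products. Both
  inequalities are integrated forms of pointwise ones: for nonnegative numbers,
  \<open>S powr p\<close> is at most (for \<open>p \<ge> 2\<close>) or at least (for \<open>1 \<le> p \<le> 2\<close>) the sum of the \<open>p\<close>-th powers
  plus a constant times \<open>S powr (p - 2) * Q\<close> (\<open>powr_sum_upper\<close>,
  \<open>powr_sum_lower\<close>). Hoelder's inequality (\<open>holder_powr\<close>) then separates \<open>S\<close> from \<open>Q\<close>.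
  For \<open>p \<ge> 2\<close> it bounds the integral of \<open>S powr (p - 2) * Q\<close> from above, with the exponents
  \<open>p / (p - 2)\<close> and \<open>p / 2\<close>. For \<open>p \<le> 2\<close> it is applied to
  \<open>Q powr (p / 2) = (S powr p) powr (1 - p / 2) * (S powr (p - 2) * Q) powr (p / 2)\<close> and bounds the
  same integral from below.

  The pointwise inequality for \<open>n\<close> numbers follows from the one for two numbers by adding one
  number at a time: the step from a partial sum \<open>T\<close> to \<open>T + y\<close> contributes
  \<open>(T + y) powr (p - 2) * (T * y)\<close>, and the weight of the earlier products moves in the right
  direction because \<open>t powr (p - 2)\<close> is monotone with the sign of \<open>p - 2\<close>.

  For two numbers, homogeneity allows \<open>a, b = (1 \<plusminus> u) / 2\<close>. Put \<open>v = u\<^sup>2\<close>. Then \<open>a * b = (1 - v) / 4\<close> is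
  affine in \<open>v\<close>, and the claim compares \<open>E v = (1 + sqrt v) powr p + (1 - sqrt v) powr p\<close> with
  an affine function on \<open>[0, 1]\<close>. The binomial series of \<open>E\<close> is \<open>2 * (\<Sum>k. (p gchoose (2 * k)) * v ^ k)\<close>,
  whose second-order behaviour is governed by the sign of \<open>(p - 2) * (p - 3)\<close>: \<open>E\<close> is convex for \<open>p \<le> 2\<close>
  and for \<open>p \<ge> 3\<close>, and concave between. The chord from \<open>v = 0\<close> to \<open>v = 1\<close>
  (\<open>sym_powr_chord\<close>, \<open>two_point_midpoint\<close>) gives the
  constant \<open>(2 powr p - 2) / 2 powr (p - 2)\<close>, which is sharp at \<open>a = b\<close>: as a lower bound for
  \<open>p \<le> 2\<close> and as an upper bound for \<open>2 \<le> p \<le> 3\<close>. For \<open>p \<ge> 3\<close> the tangent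
  at \<open>v = 1\<close>, where one of the numbers vanishes (\<open>sym_powr_tangent\<close>, \<open>two_point_endpoint\<close>), gives the constant \<open>p\<close>. The convexity is proved
  by differentiation instead of the series: \<open>E'\<close> is a multiple of the slope through the origin of
  \<open>\<phi> u = (1 + u) powr (p - 1) - (1 - u) powr (p - 1)\<close>, so it is monotone once \<open>\<phi>\<close> is convex or concave
  (\<open>powr_difference_star_shaped\<close>).
\<close>

section \<open>Convexity of the symmetrised power\<close>

lemma mean_value_obtain:
  fixes g g' :: "real \<Rightarrow> real"
  assumes "a < b" and "continuous_on {a..b} g"
    and der: "\<And>x. a < x \<Longrightarrow> x < b \<Longrightarrow> (g has_real_derivative g' x) (at x)"
  obtains z where "a < z" "z < b" "g b - g a = (b - a) * g' z"
  using MVT[OF assms(1,2)] der by (metis DERIV_unique real_differentiable_def)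

text \<open>
  Differentiability is only required inside the interval, since the functions below have singular
  derivatives at its endpoints. By the mean value theorem, the slopes of the graph to the left and to
  the right of \<open>v\<close> are values of \<open>g'\<close> at points on either side of \<open>v\<close>.
\<close>
lemma chord_above_graph:
  fixes g g' :: "real \<Rightarrow> real"
  assumes cont: "continuous_on {a..b} g"
    and der: "\<And>x. a < x \<Longrightarrow> x < b \<Longrightarrow> (g has_real_derivative g' x) (at x)"
    and mono: "\<And>x y. a < x \<Longrightarrow> x \<le> y \<Longrightarrow> y < b \<Longrightarrow> g' x \<le> g' y"
    and v: "a \<le> v" "v \<le> b"
  shows "(b - a) * g v \<le> (b - v) * g a + (v - a) * g b"
proof (cases "v = a \<or> v = b")
  case False
  with v have av: "a < v" and vb: "v < b" by auto
  have sub: "continuous_on {a..v} g" "continuous_on {v..b} g"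
    using v by (auto intro: continuous_on_subset[OF cont])
  obtain x where x: "a < x" "x < v" "g v - g a = (v - a) * g' x"
    by (rule mean_value_obtain[OF av sub(1), of g']) (use vb der in auto)
  obtain y where y: "v < y" "y < b" "g b - g v = (b - v) * g' y"
    by (rule mean_value_obtain[OF vb sub(2), of g']) (use av der in auto)
  have "(b - v) * (v - a) * g' x \<le> (b - v) * (v - a) * g' y"
    using x y av vb by (intro mult_left_mono mono) auto
  hence "(b - v) * (g v - g a) \<le> (v - a) * (g b - g v)"
    using x(3) y(3) by (simp add: mult_ac)
  thus ?thesis by (simp add: algebra_simps)
qed auto

text \<open>
  The difference of powers vanishes at \<open>0\<close> and its second derivative is
  \<open>q * (q - 1) * ((1 + u) powr (q - 2) - (1 - u) powr (q - 2))\<close>, which has the sign of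
  \<open>(q - 1) * (q - 2)\<close>. So it is convex or concave, and its slope through the origin is monotone. The
  factor \<open>s\<close> is a sign that covers both cases at once.
\<close>
lemma powr_difference_star_shaped:
  fixes q s :: real
  assumes q: "0 < q" and sgn: "0 \<le> s * ((q - 1) * (q - 2))"
    and uw: "0 \<le> u" "u \<le> w" "w \<le> 1"
  shows "w * (s * ((1 + u) powr q - (1 - u) powr q)) \<le> u * (s * ((1 + w) powr q - (1 - w) powr q))"
proof -
  define d where "d = (\<lambda>x. s * (q * ((1 + x) powr (q - 1) + (1 - x) powr (q - 1))))"
  have d_mono: "d x \<le> d y" if xy: "0 < x" "x \<le> y" "y < 1" for x y
    unfolding d_def
  proof (rule DERIV_nonneg_imp_nondecreasing[OF \<open>x \<le> y\<close>])
    fix z assume z: "x \<le> z" "z \<le> y"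
    let ?k = "(1 + z) powr (q - 2) - (1 - z) powr (q - 2)"
    have z01: "0 < z" "z < 1" using z xy by auto
    have "0 \<le> (q - 2) * ?k"
    proof (cases "q \<ge> 2")
      case True
      then have "0 \<le> ?k" using z01 powr_mono2[of "q - 2" "1 - z" "1 + z"] by simp
      with True show ?thesis by simp
    next
      case False
      then have "?k \<le> 0" using z01 powr_mono2'[of "q - 2" "1 - z" "1 + z"] by simp
      with False show ?thesis by (simp add: mult_nonpos_nonpos)
    qed
    moreover have "?k = 0" if "q = 2" using that z01 by simp
    ultimately have "0 \<le> (s * (q - 1)) * ?k"
      using sgn by (cases q "2::real" rule: linorder_cases)
        (auto simp: zero_le_mult_iff mult.assoc[symmetric])
    hence "0 \<le> q * ((s * (q - 1)) * ?k)" using q by simp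
    moreover have "((\<lambda>x. s * (q * ((1 + x) powr (q - 1) + (1 - x) powr (q - 1))))
        has_real_derivative q * ((s * (q - 1)) * ?k)) (at z)"
      using z01 by (auto intro!: derivative_eq_intros simp: algebra_simps)
    ultimately show "\<exists>y. ((\<lambda>x. s * (q * ((1 + x) powr (q - 1) + (1 - x) powr (q - 1))))
        has_real_derivative y) (at z) \<and> 0 \<le> y" by blast
  qed
  have "(w - 0) * (s * ((1 + u) powr q - (1 - u) powr q))
      \<le> (w - u) * (s * ((1 + 0) powr q - (1 - 0) powr q))
        + (u - 0) * (s * ((1 + w) powr q - (1 - w) powr q))"
  proof (rule chord_above_graph[where g' = d and g = "\<lambda>u. s * ((1 + u) powr q - (1 - u) powr q)"])
    show "continuous_on {0..w} (\<lambda>u. s * ((1 + u) powr q - (1 - u) powr q))"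
      using q uw by (intro continuous_intros continuous_on_powr') auto
    show "((\<lambda>u. s * ((1 + u) powr q - (1 - u) powr q)) has_real_derivative d x) (at x)"
      if "0 < x" "x < w" for x
      using that uw unfolding d_def by (auto intro!: derivative_eq_intros simp: algebra_simps)
  qed (use uw d_mono in auto)
  thus ?thesis by simp
qed

text \<open>
  As a function of \<open>v\<close>, this is twice the even part of the binomial series of \<open>(1 + u) powr p\<close>, with
  \<open>u\<^sup>2\<close> replaced by \<open>v\<close>.
\<close>
definition sym_powr :: "real \<Rightarrow> real \<Rightarrow> real" where
  "sym_powr p v = (1 + sqrt v) powr p + (1 - sqrt v) powr p"

definition sym_powr_deriv :: "real \<Rightarrow> real \<Rightarrow> real" where
  "sym_powr_deriv p v = p * ((1 + sqrt v) powr (p - 1) - (1 - sqrt v) powr (p - 1)) / (2 * sqrt v)"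

lemma sym_powr_has_derivative:
  assumes "0 < v" "v < 1"
  shows "(sym_powr p has_real_derivative sym_powr_deriv p v) (at v)"
proof -
  have "sqrt v < 1" "0 < sqrt v" "0 < 1 + sqrt v" using assms by (auto intro: add_pos_pos)
  thus ?thesis unfolding sym_powr_def[abs_def] sym_powr_deriv_def using assms
    by (auto intro!: derivative_eq_intros simp: divide_simps right_diff_distrib)
qed

lemma continuous_on_sym_powr:
  assumes "0 < p"
  shows "continuous_on {0..1} (sym_powr p)"
  unfolding sym_powr_def[abs_def]
  using assms by (intro continuous_intros continuous_on_powr') auto

lemma sym_powr_deriv_mono:
  assumes p: "1 < p" and sgn: "0 \<le> s * ((p - 2) * (p - 3))"
    and uv: "0 < u" "u \<le> v" "v \<le> 1"
  shows "s * sym_powr_deriv p u \<le> s * sym_powr_deriv p v"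
proof -
  let ?d = "\<lambda>x. (1 + sqrt x) powr (p - 1) - (1 - sqrt x) powr (p - 1)"
  have "sqrt v * (s * ?d u) \<le> sqrt u * (s * ?d v)"
    by (rule powr_difference_star_shaped) (use p sgn uv in \<open>auto simp: algebra_simps\<close>)
  moreover have "0 < sqrt u" "0 < sqrt v" using uv by auto
  ultimately have "s * ?d u / sqrt u \<le> s * ?d v / sqrt v"
    by (simp add: divide_simps mult_ac)
  hence "p / 2 * (s * ?d u / sqrt u) \<le> p / 2 * (s * ?d v / sqrt v)"
    using p by (intro mult_left_mono) auto
  thus ?thesis by (simp add: sym_powr_deriv_def mult_ac)
qed

lemma sym_powr_chord:
  assumes p: "1 < p" and sgn: "0 \<le> s * ((p - 2) * (p - 3))" and v: "0 \<le> v" "v \<le> 1"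
  shows "s * sym_powr p v \<le> s * (2 * (1 - v) + 2 powr p * v)"
proof -
  have "(1 - 0) * (s * sym_powr p v)
      \<le> (1 - v) * (s * sym_powr p 0) + (v - 0) * (s * sym_powr p 1)"
  proof (rule chord_above_graph[where g' = "\<lambda>x. s * sym_powr_deriv p x"
        and g = "\<lambda>v. s * sym_powr p v"])
    show "continuous_on {0..1} (\<lambda>v. s * sym_powr p v)"
      using p by (intro continuous_intros continuous_on_sym_powr) auto
  qed (use v sym_powr_has_derivative sym_powr_deriv_mono[OF p sgn]
      in \<open>auto intro!: derivative_eq_intros\<close>)
  thus ?thesis using p by (simp add: sym_powr_def algebra_simps)
qed

text \<open>
  A convex function lies above its tangent at \<open>v = 1\<close>, whose slope is \<open>p / 4 * 2 powr p\<close>.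
\<close>
lemma sym_powr_tangent:
  assumes p: "3 \<le> p" and v: "0 \<le> v" "v \<le> 1"
  shows "2 powr p * (1 - p / 4 * (1 - v)) \<le> sym_powr p v"
proof (cases "v = 1")
  case False
  with v have v1: "v < 1" by simp
  have sub: "continuous_on {v..1} (sym_powr p)"
    using v p by (auto intro: continuous_on_subset[OF continuous_on_sym_powr])
  obtain z where z: "v < z" "z < 1" "sym_powr p 1 - sym_powr p v = (1 - v) * sym_powr_deriv p z"
    by (rule mean_value_obtain[OF v1 sub, of "sym_powr_deriv p"])
       (use v sym_powr_has_derivative in auto)
  have "1 * sym_powr_deriv p z \<le> 1 * sym_powr_deriv p 1"
    by (rule sym_powr_deriv_mono) (use p z v in auto)
  hence "(1 - v) * sym_powr_deriv p z \<le> (1 - v) * sym_powr_deriv p 1"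
    using v1 by (intro mult_left_mono) auto
  moreover have "sym_powr_deriv p 1 = p / 4 * 2 powr p" "sym_powr p 1 = 2 powr p"
    using p by (auto simp: sym_powr_deriv_def sym_powr_def powr_diff)
  ultimately have "2 powr p - sym_powr p v \<le> (1 - v) * (p / 4 * 2 powr p)" using z(3) by simp
  moreover have "2 powr p * (1 - p / 4 * (1 - v)) = 2 powr p - (1 - v) * (p / 4 * 2 powr p)"
    by (simp add: algebra_simps)
  ultimately show ?thesis by linarith
qed (use p in \<open>simp add: sym_powr_def\<close>)

section \<open>The inequality for two numbers\<close>

text \<open>
  The constant for which the inequality for two numbers is an equality at \<open>a = b\<close>.
\<close>
definition midpoint_const :: "real \<Rightarrow> real" where
  "midpoint_const p = (2 powr p - 2) / 2 powr (p - 2)"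

text \<open>
  The change of variables from the pair \<open>a, b\<close> to its sum and its relative difference, whose square is
  \<open>v\<close>. It turns \<open>a * b\<close> into an affine function of \<open>v\<close>.
\<close>
lemma powr_sum_eq_sym_powr:
  fixes a b :: real
  assumes ab: "0 \<le> a" "0 \<le> b" "0 < a + b" and p: "0 < p"
  defines "v \<equiv> ((a - b) / (a + b))\<^sup>2"
  shows "0 \<le> v" "v \<le> 1"
    and "a powr p + b powr p = (a + b) powr p / 2 powr p * sym_powr p v"
    and "(a + b) powr (p - 2) * (a * b) = (a + b) powr p * (1 - v) / 4"
proof -
  show "0 \<le> v" by (simp add: v_def)
  have "\<bar>a - b\<bar> \<le> a + b" using ab by auto
  hence "\<bar>(a - b) / (a + b)\<bar> \<le> 1" using ab by (simp add: abs_divide)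
  thus "v \<le> 1" unfolding v_def by (simp add: abs_square_le_1)
  have c: "((a + b) / 2 * x) powr p = (a + b) powr p / 2 powr p * x powr p" if "0 \<le> x" for x
    using that ab by (simp add: powr_mult powr_divide)
  have s: "sqrt v = \<bar>a - b\<bar> / (a + b)" using ab by (simp add: v_def)
  \<comment> \<open>The square root of \<open>v\<close> loses the sign of \<open>a - b\<close>, so the pair is recovered as maximum and minimum.\<close>
  have "(a + b) / 2 * (1 + \<bar>a - b\<bar> / (a + b)) = max a b"
    "(a + b) / 2 * (1 - \<bar>a - b\<bar> / (a + b)) = min a b"
    using ab by (auto simp: field_simps max_def min_def abs_if)
  moreover have "0 \<le> 1 - \<bar>a - b\<bar> / (a + b)" using ab by (simp add: field_simps)
  moreover have "0 \<le> 1 + \<bar>a - b\<bar> / (a + b)" using ab by simp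
  ultimately have "max a b powr p + min a b powr p = (a + b) powr p / 2 powr p * sym_powr p v"
    using c[of "1 + \<bar>a - b\<bar> / (a + b)"] c[of "1 - \<bar>a - b\<bar> / (a + b)"]
    unfolding sym_powr_def s by (simp add: distrib_left)
  thus "a powr p + b powr p = (a + b) powr p / 2 powr p * sym_powr p v"
    by (auto simp: max_def min_def split: if_splits)
  have "(a + b)\<^sup>2 * (1 - v) = (a + b)\<^sup>2 - (a - b)\<^sup>2"
    unfolding v_def power_divide using ab by (simp add: right_diff_distrib)
  also have "\<dots> = 4 * (a * b)" by (simp add: power2_eq_square algebra_simps)
  finally have "1 - v = 4 * (a * b) / (a + b)\<^sup>2"
    using ab by (simp add: nonzero_eq_divide_eq mult.commute)
  thus "(a + b) powr (p - 2) * (a * b) = (a + b) powr p * (1 - v) / 4"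
    using ab by (simp add: powr_diff)
qed

text \<open>
  The chord bound in the original variables. With \<open>s = 1\<close> it is a lower bound for \<open>(a + b) powr p\<close>, with
  \<open>s = - 1\<close> an upper bound.
\<close>
lemma two_point_midpoint:
  fixes a b :: real
  assumes p: "1 < p" and sgn: "0 \<le> s * ((p - 2) * (p - 3))" and ab: "0 \<le> a" "0 \<le> b"
  shows "s * (a powr p + b powr p + midpoint_const p * ((a + b) powr (p - 2) * (a * b)))
    \<le> s * (a + b) powr p"
proof (cases "a + b = 0")
  case False
  with ab have pos: "0 < a + b" by simp
  define v where "v = ((a - b) / (a + b))\<^sup>2"
  note r = powr_sum_eq_sym_powr[OF ab pos, of p, folded v_def]
  define K T where "K = (2::real) powr p" and "T = (a + b) powr p / K"
  have K: "0 < K" and T: "0 \<le> T" "(a + b) powr p = T * K" by (auto simp: K_def T_def)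
  have sums: "a powr p + b powr p = T * sym_powr p v"
    "(a + b) powr (p - 2) * (a * b) = T * K * (1 - v) / 4"
    using r(3,4) p by (auto simp: K_def T_def)
  have const: "midpoint_const p = 4 * (K - 2) / K"
    by (simp add: midpoint_const_def powr_diff K_def)
  have "T * (s * sym_powr p v) \<le> T * (s * (2 * (1 - v) + K * v))"
    unfolding K_def using r p T(1) by (intro mult_left_mono[OF sym_powr_chord[OF p sgn]]) auto
  moreover have "midpoint_const p * (T * K * (1 - v) / 4) = T * ((K - 2) * (1 - v))"
    using K by (simp add: const) (simp add: algebra_simps)
  hence "s * (T * sym_powr p v + midpoint_const p * (T * K * (1 - v) / 4))
      = T * (s * sym_powr p v) + s * (T * ((K - 2) * (1 - v)))"
    by (simp only: distrib_left mult_ac)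
  moreover have "T * (s * (2 * (1 - v) + K * v)) + s * (T * ((K - 2) * (1 - v))) = s * (T * K)"
    by (simp add: algebra_simps)
  ultimately show ?thesis unfolding sums T(2) by linarith
qed (use ab in \<open>simp add: add_nonneg_eq_0_iff\<close>)

text \<open>
  The tangent bound in the original variables. The tangent point \<open>v = 1\<close> is the case in which \<open>a\<close> or
  \<open>b\<close> vanishes, which forces the constant \<open>p\<close>.
\<close>
lemma two_point_endpoint:
  fixes a b :: real
  assumes p: "3 \<le> p" and ab: "0 \<le> a" "0 \<le> b"
  shows "(a + b) powr p \<le> a powr p + b powr p + p * ((a + b) powr (p - 2) * (a * b))"
proof (cases "a + b = 0")
  case False
  with ab have pos: "0 < a + b" by simp
  define v where "v = ((a - b) / (a + b))\<^sup>2"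
  note r = powr_sum_eq_sym_powr[OF ab pos, of p, folded v_def]
  have "(a + b) powr p / 2 powr p * (2 powr p * (1 - p / 4 * (1 - v)))
      \<le> (a + b) powr p / 2 powr p * sym_powr p v"
    using r p by (intro mult_left_mono[OF sym_powr_tangent[OF p]]) auto
  hence "(a + b) powr p - p * ((a + b) powr p * (1 - v) / 4) \<le> a powr p + b powr p"
    using r(3) p by (simp add: algebra_simps)
  thus ?thesis unfolding r(4)[OF less_le_trans[OF zero_less_numeral p], symmetric] by linarith
qed (use ab in \<open>simp add: add_nonneg_eq_0_iff\<close>)

lemma two_point_upper:
  fixes a b :: real
  assumes p: "2 \<le> p" and ab: "0 \<le> a" "0 \<le> b"
  shows "(a + b) powr p
    \<le> a powr p + b powr p + max p (midpoint_const p) * ((a + b) powr (p - 2) * (a * b))"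
proof -
  have nn: "0 \<le> (a + b) powr (p - 2) * (a * b)" using ab by simp
  have "(a + b) powr p
      \<le> a powr p + b powr p + (if p \<le> 3 then midpoint_const p else p) * ((a + b) powr (p - 2) * (a * b))"
  proof (cases "p \<le> 3")
    case True
    then have "0 \<le> - 1 * ((p - 2) * (p - 3))" using p by (simp add: mult_nonneg_nonpos)
    from two_point_midpoint[OF _ this ab] p True show ?thesis by simp
  next
    case False
    with two_point_endpoint[of p a b] ab show ?thesis by simp
  qed
  also have "\<dots> \<le> a powr p + b powr p + max p (midpoint_const p) * ((a + b) powr (p - 2) * (a * b))"
    using nn by (intro add_left_mono mult_right_mono) auto
  finally show ?thesis .
qed

lemma two_point_lower:
  fixes a b :: real
  assumes p: "1 \<le> p" "p \<le> 2" and ab: "0 \<le> a" "0 \<le> b"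
  shows "a powr p + b powr p + midpoint_const p * ((a + b) powr (p - 2) * (a * b)) \<le> (a + b) powr p"
proof (cases "p = 1")
  case True thus ?thesis using ab by (simp add: midpoint_const_def)
next
  case False
  have "0 \<le> 1 * ((p - 2) * (p - 3))" using p by (simp add: mult_nonpos_nonpos)
  from two_point_midpoint[OF _ this ab] False p show ?thesis by simp
qed

section \<open>The inequality for finitely many numbers\<close>

definition pair_sum :: "nat \<Rightarrow> (nat \<Rightarrow> real) \<Rightarrow> real" where
  "pair_sum n x = (\<Sum>(i, j)\<in>{(i, j). 1 \<le> i \<and> i < j \<and> j \<le> n}. x i * x j)"

lemma pair_sum_0 [simp]: "pair_sum 0 x = 0"
proof -
  have "{(i, j). 1 \<le> i \<and> i < j \<and> j \<le> (0::nat)} = ({} :: (nat \<times> nat) set)" by auto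
  thus ?thesis unfolding pair_sum_def by (simp only: sum.empty)
qed

lemma pair_sum_Suc [simp]: "pair_sum (Suc n) x = pair_sum n x + (\<Sum>i=1..n. x i) * x (Suc n)"
proof -
  let ?A = "\<lambda>n. {(i, j). 1 \<le> i \<and> i < j \<and> j \<le> (n::nat)}"
  have fin: "finite (?A n)" by (rule finite_subset[of _ "{0..n} \<times> {0..n}"]) auto
  have "?A (Suc n) = ?A n \<union> (\<lambda>i. (i, Suc n)) ` {1..n}" by auto
  moreover have "?A n \<inter> (\<lambda>i. (i, Suc n)) ` {1..n} = {}" by auto
  ultimately have "pair_sum (Suc n) x
      = pair_sum n x + (\<Sum>(i, j)\<in>(\<lambda>i. (i, Suc n)) ` {1..n}. x i * x j)"
    unfolding pair_sum_def using fin by (simp add: sum.union_disjoint)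
  also have "(\<Sum>(i, j)\<in>(\<lambda>i. (i, Suc n)) ` {1..n}. x i * x j) = (\<Sum>i=1..n. x i) * x (Suc n)"
    by (subst sum.reindex) (auto simp: inj_on_def sum_distrib_right)
  finally show ?thesis .
qed

lemma pair_sum_nonneg: "(\<And>i. 1 \<le> i \<Longrightarrow> 0 \<le> x i) \<Longrightarrow> 0 \<le> pair_sum n x"
  unfolding pair_sum_def by (rule sum_nonneg) auto

lemma pair_sum_le_square:
  assumes "\<And>i. 1 \<le> i \<Longrightarrow> 0 \<le> x i"
  shows "pair_sum n x \<le> (\<Sum>i=1..n. x i)\<^sup>2"
proof (induction n)
  case (Suc n)
  have "0 \<le> (\<Sum>i=1..n. x i) * x (Suc n)" using assms by (intro mult_nonneg_nonneg sum_nonneg) auto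
  with Suc show ?case by (simp add: power2_eq_square algebra_simps add_increasing)
qed simp

text \<open>
  Each new number adds the bound for two numbers. The products collected before carry the power of a
  smaller partial sum, which may be replaced by the larger one because \<open>p - 2 \<ge> 0\<close>.
\<close>
lemma powr_sum_upper:
  assumes p: "2 \<le> p" and nn: "\<And>i. 1 \<le> i \<Longrightarrow> 0 \<le> x i"
  shows "(\<Sum>i=1..n. x i) powr p \<le> (\<Sum>i=1..n. x i powr p)
    + max p (midpoint_const p) * ((\<Sum>i=1..n. x i) powr (p - 2) * pair_sum n x)"
proof (induction n)
  case (Suc n)
  let ?C = "max p (midpoint_const p)"
  define S where "S = (\<Sum>i=1..n. x i)"
  have S: "0 \<le> S" unfolding S_def using nn by (intro sum_nonneg) auto
  have y: "0 \<le> x (Suc n)" using nn by simp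
  have Q: "0 \<le> pair_sum n x" using nn by (rule pair_sum_nonneg)
  have "?C * (S powr (p - 2) * pair_sum n x) \<le> ?C * ((S + x (Suc n)) powr (p - 2) * pair_sum n x)"
    using p S y Q by (intro mult_left_mono mult_right_mono powr_mono2) auto
  with Suc two_point_upper[OF p S y] show ?case
    unfolding S_def by (simp add: algebra_simps)
qed simp

text \<open>
  The same induction. Now \<open>p - 2 \<le> 0\<close>, so raising the partial sum lowers its power, except when the
  partial sum is \<open>0\<close>: then its power is \<open>0\<close> by convention, but all products vanish as well.
\<close>
lemma powr_sum_lower:
  assumes p: "1 \<le> p" "p \<le> 2" and nn: "\<And>i. 1 \<le> i \<Longrightarrow> 0 \<le> x i"
  shows "(\<Sum>i=1..n. x i powr p)
    + midpoint_const p * ((\<Sum>i=1..n. x i) powr (p - 2) * pair_sum n x) \<le> (\<Sum>i=1..n. x i) powr p"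
proof (induction n)
  case (Suc n)
  let ?C = "midpoint_const p"
  define S where "S = (\<Sum>i=1..n. x i)"
  have S: "0 \<le> S" unfolding S_def using nn by (intro sum_nonneg) auto
  have y: "0 \<le> x (Suc n)" using nn by simp
  have Q: "0 \<le> pair_sum n x" using nn by (rule pair_sum_nonneg)
  have C: "0 \<le> ?C" using powr_mono[of 1 p 2] p by (simp add: midpoint_const_def)
  have "(S + x (Suc n)) powr (p - 2) * pair_sum n x \<le> S powr (p - 2) * pair_sum n x"
  proof (cases "S = 0")
    case True
    with pair_sum_le_square[of x n] nn Q have "pair_sum n x = 0" by (simp add: S_def)
    thus ?thesis by simp
  next
    case False
    with S y p Q show ?thesis by (intro mult_right_mono powr_mono2') auto
  qed
  hence "?C * ((S + x (Suc n)) powr (p - 2) * pair_sum n x) \<le> ?C * (S powr (p - 2) * pair_sum n x)"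
    using C by (intro mult_left_mono) auto
  with Suc two_point_lower[OF p S y] show ?case
    unfolding S_def by (simp add: algebra_simps)
qed simp

section \<open>Hoelder's inequality and integrability\<close>

lemma young_powr:
  fixes a b \<theta> :: real
  assumes "0 \<le> \<theta>" "\<theta> \<le> 1" "0 \<le> a" "0 \<le> b"
  shows "a powr (1 - \<theta>) * b powr \<theta> \<le> (1 - \<theta>) * a + \<theta> * b"
proof (cases "a = 0 \<or> b = 0")
  case False
  with assms show ?thesis by (intro Youngs_inequality_0) auto
qed (use assms in auto)

text \<open>
  Hoelder's inequality in the form of log-convexity. Taking the weights as exponents keeps the endpoint
  \<open>\<theta> = 1\<close>, which arises for \<open>p = 2\<close>. The convention \<open>0 powr 0 = 0\<close> makes the right-hand side
  vanish when one of the integrals does, but then the integrand on the left vanishes almost everywhere too.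
\<close>
lemma holder_powr:
  fixes A B :: "'a \<Rightarrow> real"
  assumes \<theta>: "0 \<le> \<theta>" "\<theta> \<le> 1"
    and int: "integrable M A" "integrable M B"
    and nn: "\<And>x. 0 \<le> A x" "\<And>x. 0 \<le> B x"
  shows "integrable M (\<lambda>x. A x powr (1 - \<theta>) * B x powr \<theta>)"
    and "(\<integral>x. A x powr (1 - \<theta>) * B x powr \<theta> \<partial>M)
      \<le> (\<integral>x. A x \<partial>M) powr (1 - \<theta>) * (\<integral>x. B x \<partial>M) powr \<theta>"
proof -
  have [measurable]: "A \<in> borel_measurable M" "B \<in> borel_measurable M" using int by auto
  show I: "integrable M (\<lambda>x. A x powr (1 - \<theta>) * B x powr \<theta>)"
  proof (rule Bochner_Integration.integrable_bound)
    show "integrable M (\<lambda>x. (1 - \<theta>) * A x + \<theta> * B x)" using int by auto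
    show "AE x in M. norm (A x powr (1 - \<theta>) * B x powr \<theta>) \<le> norm ((1 - \<theta>) * A x + \<theta> * B x)"
      using young_powr[OF \<theta> nn] \<theta> nn by (auto intro: order_trans[OF _ abs_ge_self])
  qed measurable
  define a b where "a = (\<integral>x. A x \<partial>M)" and "b = (\<integral>x. B x \<partial>M)"
  have ab: "0 \<le> a" "0 \<le> b" unfolding a_def b_def using nn by auto
  have "(\<integral>x. A x powr (1 - \<theta>) * B x powr \<theta> \<partial>M) \<le> a powr (1 - \<theta>) * b powr \<theta>"
  proof (cases "a = 0 \<or> b = 0")
    case True
    hence "(AE x in M. A x = 0) \<or> (AE x in M. B x = 0)"
      using integral_nonneg_eq_0_iff_AE[OF int(1)] integral_nonneg_eq_0_iff_AE[OF int(2)] nn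
      by (auto simp: a_def b_def)
    hence "AE x in M. A x powr (1 - \<theta>) * B x powr \<theta> = 0" by auto
    hence "(\<integral>x. A x powr (1 - \<theta>) * B x powr \<theta> \<partial>M) = 0" by (simp add: integral_eq_zero_AE)
    thus ?thesis by simp
  next
    case False
    with ab have pos: "0 < a" "0 < b" by auto
    have "A x powr (1 - \<theta>) * B x powr \<theta>
        \<le> a powr (1 - \<theta>) * b powr \<theta> * ((1 - \<theta>) * (A x / a) + \<theta> * (B x / b))" for x
    proof -
      have "A x powr (1 - \<theta>) * B x powr \<theta>
          = a powr (1 - \<theta>) * b powr \<theta> * ((A x / a) powr (1 - \<theta>) * (B x / b) powr \<theta>)"
        using pos nn by (simp add: powr_divide)
      also have "\<dots> \<le> a powr (1 - \<theta>) * b powr \<theta> * ((1 - \<theta>) * (A x / a) + \<theta> * (B x / b))"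
        using pos nn \<theta> by (intro mult_left_mono young_powr) auto
      finally show ?thesis .
    qed
    hence "(\<integral>x. A x powr (1 - \<theta>) * B x powr \<theta> \<partial>M)
        \<le> (\<integral>x. a powr (1 - \<theta>) * b powr \<theta> * ((1 - \<theta>) * (A x / a) + \<theta> * (B x / b)) \<partial>M)"
      using I int by (intro integral_mono) auto
    also have "\<dots> = a powr (1 - \<theta>) * b powr \<theta> * ((1 - \<theta>) * (a / a) + \<theta> * (b / b))"
      using int by (simp add: a_def b_def)
    also have "\<dots> = a powr (1 - \<theta>) * b powr \<theta>" using pos by simp
    finally show ?thesis .
  qed
  thus "(\<integral>x. A x powr (1 - \<theta>) * B x powr \<theta> \<partial>M)
      \<le> (\<integral>x. A x \<partial>M) powr (1 - \<theta>) * (\<integral>x. B x \<partial>M) powr \<theta>" by (simp add: a_def b_def)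
qed

lemma Lp_norm_powr:
  assumes "r \<noteq> 0"
  shows "Lp_norm M r h powr s = (\<integral>x. \<bar>h x\<bar> powr r \<partial>M) powr (s / r)"
  by (simp add: Lp_norm_def powr_powr)

lemma Lp_norm_powr_self:
  assumes "r \<noteq> 0"
  shows "Lp_norm M r h powr r = (\<integral>x. \<bar>h x\<bar> powr r \<partial>M)"
  using assms by (simp add: Lp_norm_powr)

lemma Lp_norm_cong_AE:
  assumes "h \<in> borel_measurable M" "k \<in> borel_measurable M" "AE x in M. h x = k x"
  shows "Lp_norm M r h = Lp_norm M r k"
proof -
  have "(\<integral>x. \<bar>h x\<bar> powr r \<partial>M) = (\<integral>x. \<bar>k x\<bar> powr r \<partial>M)"
    using assms by (intro integral_cong_AE) auto
  thus ?thesis by (simp add: Lp_norm_def)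
qed

lemma borel_measurable_pair_sum:
  fixes f :: "nat \<Rightarrow> 'a \<Rightarrow> real"
  assumes "\<And>j. 1 \<le> j \<Longrightarrow> f j \<in> borel_measurable M"
  shows "(\<lambda>x. pair_sum n (\<lambda>j. f j x)) \<in> borel_measurable M"
  using assms by (induction n) auto

lemma integrable_sum_powr:
  fixes f :: "nat \<Rightarrow> 'a \<Rightarrow> real"
  assumes p: "1 \<le> p" and Lp: "\<And>j. 1 \<le> j \<Longrightarrow> f j \<in> Lp_space M p"
    and nn: "\<And>j x. 0 \<le> f j x"
  shows "integrable M (\<lambda>x. (\<Sum>j=1..n. f j x) powr p)"
proof (induction n)
  case (Suc n)
  have [measurable]: "f j \<in> borel_measurable M" if "1 \<le> j" for j
    using Lp[OF that] by (simp add: Lp_space_def)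
  have "integrable M (\<lambda>x. f (Suc n) x powr p)"
    using Lp[of "Suc n"] nn by (simp add: Lp_space_def)
  with Suc have dom: "integrable M (\<lambda>x. 2 powr p * ((\<Sum>j=1..n. f j x) powr p + f (Suc n) x powr p))"
    by auto
  have bound: "(a + b) powr p \<le> 2 powr p * (a powr p + b powr p)"
    if "0 \<le> a" "0 \<le> b" for a b :: real
  proof -
    have "(a + b) powr p \<le> (2 * max a b) powr p" using that p by (intro powr_mono2) auto
    also have "\<dots> = 2 powr p * max a b powr p" using that by (simp add: powr_mult)
    also have "\<dots> \<le> 2 powr p * (a powr p + b powr p)" by (auto simp: max_def)
    finally show ?thesis .
  qed
  have "(\<Sum>j=1..Suc n. f j x) powr p \<le> 2 powr p * ((\<Sum>j=1..n. f j x) powr p + f (Suc n) x powr p)" for x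
    using bound[of "\<Sum>j=1..n. f j x" "f (Suc n) x"] nn by (simp add: sum_nonneg)
  hence "AE x in M. norm ((\<Sum>j=1..Suc n. f j x) powr p)
      \<le> norm (2 powr p * ((\<Sum>j=1..n. f j x) powr p + f (Suc n) x powr p))"
    by (auto intro!: order_trans[OF _ abs_ge_self])
  moreover have "(\<lambda>x. (\<Sum>j=1..Suc n. f j x) powr p) \<in> borel_measurable M" by measurable
  ultimately show ?case by (intro Bochner_Integration.integrable_bound[OF dom])
qed simp

text \<open>
  Dominates the mixed term by an integrable function. For \<open>p < 2\<close> the factor \<open>S powr (p - 2)\<close> is
  unbounded near the zeros of \<open>S\<close>, and \<open>Q \<le> S\<^sup>2\<close> compensates for it.
\<close>
lemma powr_mult_pair_sum_le:
  assumes "\<And>i. 1 \<le> i \<Longrightarrow> 0 \<le> x i"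
  shows "(\<Sum>i=1..n. x i) powr (p - 2) * pair_sum n x \<le> (\<Sum>i=1..n. x i) powr p"
proof (cases "(\<Sum>i=1..n. x i) = 0")
  case False
  moreover have "0 \<le> (\<Sum>i=1..n. x i)" using assms by (intro sum_nonneg) auto
  ultimately have pos: "0 < (\<Sum>i=1..n. x i)" by simp
  have "(\<Sum>i=1..n. x i) powr (p - 2) * pair_sum n x
      \<le> (\<Sum>i=1..n. x i) powr (p - 2) * (\<Sum>i=1..n. x i)\<^sup>2"
    by (intro mult_left_mono pair_sum_le_square assms) auto
  also have "\<dots> = (\<Sum>i=1..n. x i) powr p" using pos by (simp add: powr_diff)
  finally show ?thesis .
qed simp

lemma integrable_powr_mult_pair_sum:
  fixes f :: "nat \<Rightarrow> 'a \<Rightarrow> real"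
  assumes p: "1 \<le> p" and Lp: "\<And>j. 1 \<le> j \<Longrightarrow> f j \<in> Lp_space M p"
    and nn: "\<And>j x. 0 \<le> f j x"
  shows "integrable M (\<lambda>x. (\<Sum>j=1..n. f j x) powr (p - 2) * pair_sum n (\<lambda>j. f j x))"
proof (rule Bochner_Integration.integrable_bound)
  show "integrable M (\<lambda>x. (\<Sum>j=1..n. f j x) powr p)"
    using p Lp nn by (rule integrable_sum_powr)
  have [measurable]: "f j \<in> borel_measurable M" if "1 \<le> j" for j
    using Lp[OF that] by (simp add: Lp_space_def)
  have [measurable]: "(\<lambda>x. pair_sum n (\<lambda>j. f j x)) \<in> borel_measurable M"
    by (rule borel_measurable_pair_sum) simp
  show "(\<lambda>x. (\<Sum>j=1..n. f j x) powr (p - 2) * pair_sum n (\<lambda>j. f j x)) \<in> borel_measurable M"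
    by measurable
  have "(\<Sum>j=1..n. f j x) powr (p - 2) * pair_sum n (\<lambda>j. f j x) \<le> (\<Sum>j=1..n. f j x) powr p" for x
    using nn by (intro powr_mult_pair_sum_le)
  thus "AE x in M. norm ((\<Sum>j=1..n. f j x) powr (p - 2) * pair_sum n (\<lambda>j. f j x))
      \<le> norm ((\<Sum>j=1..n. f j x) powr p)"
    using nn by (simp add: abs_mult pair_sum_nonneg)
qed

lemma integrable_pair_sum_powr:
  fixes f :: "nat \<Rightarrow> 'a \<Rightarrow> real"
  assumes p: "1 \<le> p" and Lp: "\<And>j. 1 \<le> j \<Longrightarrow> f j \<in> Lp_space M p"
    and nn: "\<And>j x. 0 \<le> f j x"
  shows "integrable M (\<lambda>x. pair_sum n (\<lambda>j. f j x) powr (p / 2))"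
proof (rule Bochner_Integration.integrable_bound)
  show "integrable M (\<lambda>x. (\<Sum>j=1..n. f j x) powr p)"
    using p Lp nn by (rule integrable_sum_powr)
  have [measurable]: "f j \<in> borel_measurable M" if "1 \<le> j" for j
    using Lp[OF that] by (simp add: Lp_space_def)
  have [measurable]: "(\<lambda>x. pair_sum n (\<lambda>j. f j x)) \<in> borel_measurable M"
    by (rule borel_measurable_pair_sum) simp
  show "(\<lambda>x. pair_sum n (\<lambda>j. f j x) powr (p / 2)) \<in> borel_measurable M"
    by measurable
  have "pair_sum n (\<lambda>j. f j x) powr (p / 2) \<le> (\<Sum>j=1..n. f j x) powr p" for x
  proof -
    have "pair_sum n (\<lambda>j. f j x) powr (p / 2) \<le> ((\<Sum>j=1..n. f j x)\<^sup>2) powr (p / 2)"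
      using p nn by (intro powr_mono2 pair_sum_le_square pair_sum_nonneg) auto
    also have "\<dots> = (\<Sum>j=1..n. f j x) powr p"
      using nn by (simp add: sum_nonneg powr_powr flip: powr_numeral)
    finally show ?thesis .
  qed
  thus "AE x in M. norm (pair_sum n (\<lambda>j. f j x) powr (p / 2)) \<le> norm ((\<Sum>j=1..n. f j x) powr p)"
    by simp
qed

section \<open>The inequalities for norms\<close>

lemma Lp_sum_upper:
  fixes f :: "nat \<Rightarrow> 'a \<Rightarrow> real"
  assumes p: "2 \<le> p" and Lp: "\<And>j. 1 \<le> j \<Longrightarrow> f j \<in> Lp_space M p"
    and nn: "\<And>j x. 0 \<le> f j x"
  shows "Lp_norm M p (\<lambda>x. \<Sum>j=1..n. f j x) powr p
    \<le> (\<Sum>j=1..n. Lp_norm M p (f j) powr p)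
      + max p (midpoint_const p) * Lp_norm M p (\<lambda>x. \<Sum>j=1..n. f j x) powr (p - 2)
        * Lp_norm M (p / 2) (\<lambda>x. pair_sum n (\<lambda>j. f j x))"
proof -
  define S Q where "S = (\<lambda>x. \<Sum>j=1..n. f j x)" and "Q = (\<lambda>x. pair_sum n (\<lambda>j. f j x))"
  have S: "0 \<le> S x" and Q: "0 \<le> Q x" for x
    unfolding S_def Q_def using nn by (auto intro: sum_nonneg pair_sum_nonneg)
  have p1: "1 \<le> p" using p by simp
  have int: "integrable M (\<lambda>x. S x powr p)" "integrable M (\<lambda>x. S x powr (p - 2) * Q x)"
    "integrable M (\<lambda>x. Q x powr (p / 2))"
    unfolding S_def Q_def using p1 Lp nn
    by (intro integrable_sum_powr integrable_powr_mult_pair_sum integrable_pair_sum_powr; simp)+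
  have fint: "integrable M (\<lambda>x. f j x powr p)" if "1 \<le> j" for j
    using Lp[OF that] nn by (simp add: Lp_space_def)
  have sumint: "integrable M (\<lambda>x. \<Sum>j=1..n. f j x powr p)"
    "(\<integral>x. (\<Sum>j=1..n. f j x powr p) \<partial>M) = (\<Sum>j=1..n. \<integral>x. f j x powr p \<partial>M)"
    by (intro Bochner_Integration.integrable_sum Bochner_Integration.integral_sum fint; simp)+
  have "(\<integral>x. S x powr p \<partial>M)
      \<le> (\<integral>x. (\<Sum>j=1..n. f j x powr p) + max p (midpoint_const p) * (S x powr (p - 2) * Q x) \<partial>M)"
  proof (rule integral_mono)
    show "S x powr p \<le> (\<Sum>j=1..n. f j x powr p) + max p (midpoint_const p) * (S x powr (p - 2) * Q x)"
      for x unfolding S_def Q_def using p nn by (intro powr_sum_upper) auto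
  qed (intro int sumint Bochner_Integration.integrable_add integrable_mult_right)+
  also have "\<dots> = (\<Sum>j=1..n. \<integral>x. f j x powr p \<partial>M)
      + max p (midpoint_const p) * (\<integral>x. S x powr (p - 2) * Q x \<partial>M)"
    by (simp only: sumint int integrable_mult_right Bochner_Integration.integral_add
        integral_mult_right_zero)
  finally have pointwise: "(\<integral>x. S x powr p \<partial>M) \<le> \<dots>" .
  \<comment> \<open>Hoelder's inequality with weight \<open>2 / p\<close>, which makes the factors \<open>p\<close>-th and \<open>p / 2\<close>-th powers.\<close>
  have "S x powr (p - 2) * Q x = (S x powr p) powr (1 - 2 / p) * (Q x powr (p / 2)) powr (2 / p)" for x
    using p Q[of x] by (simp add: powr_powr right_diff_distrib)
  hence "(\<integral>x. S x powr (p - 2) * Q x \<partial>M)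
      \<le> (\<integral>x. S x powr p \<partial>M) powr (1 - 2 / p) * (\<integral>x. Q x powr (p / 2) \<partial>M) powr (2 / p)"
    using holder_powr(2)[OF _ _ int(1,3), of "2 / p"] p by simp
  also have "\<dots> = Lp_norm M p S powr (p - 2) * Lp_norm M (p / 2) Q"
    using p S Q by (simp add: Lp_norm_powr Lp_norm_def[of _ "p / 2"] diff_divide_distrib)
  finally have "max p (midpoint_const p) * (\<integral>x. S x powr (p - 2) * Q x \<partial>M)
      \<le> max p (midpoint_const p) * (Lp_norm M p S powr (p - 2) * Lp_norm M (p / 2) Q)"
    using p by (intro mult_left_mono) auto
  with pointwise p S nn show ?thesis
    unfolding S_def[symmetric] Q_def[symmetric] by (simp add: Lp_norm_powr_self mult.assoc)
qed

lemma Lp_sum_lower: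
  fixes f :: "nat \<Rightarrow> 'a \<Rightarrow> real"
  assumes p: "1 \<le> p" "p \<le> 2" and Lp: "\<And>j. 1 \<le> j \<Longrightarrow> f j \<in> Lp_space M p"
    and nn: "\<And>j x. 0 \<le> f j x"
    and nz: "\<not> (AE x in M. (\<Sum>j=1..n. f j x) = 0)"
  shows "(\<Sum>j=1..n. Lp_norm M p (f j) powr p)
      + midpoint_const p * (Lp_norm M (p / 2) (\<lambda>x. pair_sum n (\<lambda>j. f j x))
          / Lp_norm M p (\<lambda>x. \<Sum>j=1..n. f j x) powr (2 - p))
    \<le> Lp_norm M p (\<lambda>x. \<Sum>j=1..n. f j x) powr p"
proof -
  define S Q where "S = (\<lambda>x. \<Sum>j=1..n. f j x)" and "Q = (\<lambda>x. pair_sum n (\<lambda>j. f j x))"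
  have S: "0 \<le> S x" and Q: "0 \<le> Q x" for x
    unfolding S_def Q_def using nn by (auto intro: sum_nonneg pair_sum_nonneg)
  have QS: "Q x \<le> (S x)\<^sup>2" for x unfolding S_def Q_def using nn by (intro pair_sum_le_square)
  have int: "integrable M (\<lambda>x. S x powr p)" "integrable M (\<lambda>x. S x powr (p - 2) * Q x)"
    "integrable M (\<lambda>x. Q x powr (p / 2))"
    unfolding S_def Q_def using p(1) Lp nn
    by (intro integrable_sum_powr integrable_powr_mult_pair_sum integrable_pair_sum_powr; simp)+
  have fint: "integrable M (\<lambda>x. f j x powr p)" if "1 \<le> j" for j
    using Lp[OF that] nn by (simp add: Lp_space_def)
  have sumint: "integrable M (\<lambda>x. \<Sum>j=1..n. f j x powr p)"
    "(\<integral>x. (\<Sum>j=1..n. f j x powr p) \<partial>M) = (\<Sum>j=1..n. \<integral>x. f j x powr p \<partial>M)"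
    by (intro Bochner_Integration.integrable_sum Bochner_Integration.integral_sum fint; simp)+
  have C: "0 \<le> midpoint_const p" using powr_mono[of 1 p 2] p by (simp add: midpoint_const_def)
  define I J where "I = (\<integral>x. S x powr p \<partial>M)" and "J = (\<integral>x. S x powr (p - 2) * Q x \<partial>M)"
  have J: "0 \<le> J" unfolding J_def using Q by simp
  have "\<not> (AE x in M. S x powr p = 0)" using nz unfolding S_def by simp
  hence "I \<noteq> 0" using integral_nonneg_eq_0_iff_AE[OF int(1)] by (simp add: I_def)
  moreover have "0 \<le> I" unfolding I_def by simp
  ultimately have I: "0 < I" by simp
  have "(\<Sum>j=1..n. \<integral>x. f j x powr p \<partial>M) + midpoint_const p * J
      = (\<integral>x. (\<Sum>j=1..n. f j x powr p) + midpoint_const p * (S x powr (p - 2) * Q x) \<partial>M)"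
    unfolding J_def by (simp only: sumint int integrable_mult_right Bochner_Integration.integral_add
        integral_mult_right_zero)
  also have "\<dots> \<le> I"
    unfolding I_def
  proof (rule integral_mono)
    show "(\<Sum>j=1..n. f j x powr p) + midpoint_const p * (S x powr (p - 2) * Q x) \<le> S x powr p"
      for x unfolding S_def Q_def using p nn by (intro powr_sum_lower) auto
  qed (intro int sumint Bochner_Integration.integrable_add integrable_mult_right)+
  finally have pointwise: "(\<Sum>j=1..n. \<integral>x. f j x powr p \<partial>M) + midpoint_const p * J \<le> I" .
  \<comment> \<open>Reverse Hoelder: the negative power of \<open>S\<close> is absorbed, so that the exponents \<open>1 - p / 2\<close> and \<open>p / 2\<close> are nonnegative.\<close>
  have split: "Q x powr (p / 2) = (S x powr p) powr (1 - p / 2) * (S x powr (p - 2) * Q x) powr (p / 2)" for x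
  proof (cases "S x = 0")
    case True
    with Q[of x] QS[of x] show ?thesis by simp
  next
    case False
    have "p * (1 - p / 2) + (p - 2) * (p / 2) = 0" by (simp add: field_simps)
    hence "(S x powr p) powr (1 - p / 2) * (S x powr (p - 2)) powr (p / 2) = 1"
      using False by (simp add: powr_powr flip: powr_add)
    thus ?thesis by (simp add: powr_mult mult.assoc[symmetric])
  qed
  have "Lp_norm M (p / 2) Q = (\<integral>x. Q x powr (p / 2) \<partial>M) powr (2 / p)"
    using Q by (simp add: Lp_norm_def)
  also have "\<dots> \<le> (I powr (1 - p / 2) * J powr (p / 2)) powr (2 / p)"
    unfolding split I_def J_def using p Q
    by (intro powr_mono2 holder_powr(2) int) auto
  also have "\<dots> = I powr ((1 - p / 2) * (2 / p)) * J"
    using p J I by (simp add: powr_mult powr_powr)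
  also have "(1 - p / 2) * (2 / p) = (2 - p) / p" using p by (simp add: field_simps)
  also have "I powr ((2 - p) / p) = Lp_norm M p S powr (2 - p)"
    using p S by (simp add: Lp_norm_powr I_def)
  finally have "Lp_norm M (p / 2) Q / Lp_norm M p S powr (2 - p) \<le> J"
    using I p S by (simp add: Lp_norm_powr I_def[symmetric] divide_le_eq mult.commute)
  hence "midpoint_const p * (Lp_norm M (p / 2) Q / Lp_norm M p S powr (2 - p)) \<le> midpoint_const p * J"
    using C by (intro mult_left_mono)
  with pointwise p S nn show ?thesis
    unfolding S_def[symmetric] Q_def[symmetric] by (simp add: Lp_norm_powr_self I_def)
qed

text \<open>
  Replacing each function by its absolute value changes neither the norms nor, up to null sets, the
  sums and products, so nonnegativity may be assumed everywhere.
\<close>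
theorem theorem1p2:
  fixes M :: "'a measure" and f :: "nat \<Rightarrow> 'a \<Rightarrow> real" and p :: real
  assumes Lp: "\<And>j. 1 \<le> j \<Longrightarrow> f j \<in> Lp_space M p"
    and nonneg: "\<And>j. 1 \<le> j \<Longrightarrow> AE x in M. 0 \<le> f j x"
  shows "(2 \<le> p \<longrightarrow>
      (\<forall>n::nat.
        Lp_norm M p (\<lambda>x. \<Sum>j=1..n. f j x) powr p
          \<le> (\<Sum>j=1..n. Lp_norm M p (f j) powr p)
            + max p ((2 powr p - 2) / 2 powr (p - 2))
              * Lp_norm M p (\<lambda>x. \<Sum>j=1..n. f j x) powr (p - 2)
              * Lp_norm M (p / 2) (\<lambda>x. \<Sum>(i, j)\<in>{(i, j). 1 \<le> i \<and> i < j \<and> j \<le> n}. f i x * f j x)))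
    \<and> (1 \<le> p \<and> p \<le> 2 \<longrightarrow>
      (\<forall>n::nat. \<not> (AE x in M. (\<Sum>j=1..n. f j x) = 0) \<longrightarrow>
        Lp_norm M p (\<lambda>x. \<Sum>j=1..n. f j x) powr p
          \<ge> (\<Sum>j=1..n. Lp_norm M p (f j) powr p)
            + (2 powr p - 2) / 2 powr (p - 2)
              * (Lp_norm M (p / 2) (\<lambda>x. \<Sum>(i, j)\<in>{(i, j). 1 \<le> i \<and> i < j \<and> j \<le> n}. f i x * f j x)
                 / Lp_norm M p (\<lambda>x. \<Sum>j=1..n. f j x) powr (2 - p))))"
proof -
  define g where "g = (\<lambda>j x. \<bar>f j x\<bar>)"
  have fm [measurable]: "f j \<in> borel_measurable M" if "1 \<le> j" for j
    using Lp[OF that] by (simp add: Lp_space_def)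
  have gm [measurable]: "g j \<in> borel_measurable M" if "1 \<le> j" for j
    using fm[OF that] unfolding g_def by measurable
  have gLp: "g j \<in> Lp_space M p" if "1 \<le> j" for j
    using Lp[OF that] fm[OF that] by (simp add: Lp_space_def g_def)
  have gnn: "0 \<le> g j x" for j x by (simp add: g_def)
  have "AE x in M. \<forall>j. 1 \<le> j \<longrightarrow> 0 \<le> f j x"
    using nonneg by (subst AE_all_countable) auto
  hence fg: "AE x in M. \<forall>j. 1 \<le> j \<longrightarrow> f j x = g j x" by eventually_elim (simp add: g_def)
  have norm_f: "Lp_norm M p (f j) = Lp_norm M p (g j)" for j
    by (simp add: Lp_norm_def g_def)
  have AE_S: "AE x in M. (\<Sum>j=1..n. f j x) = (\<Sum>j=1..n. g j x)" for n
    using fg by eventually_elim (auto intro: sum.cong)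
  have norm_S: "Lp_norm M p (\<lambda>x. \<Sum>j=1..n. f j x) = Lp_norm M p (\<lambda>x. \<Sum>j=1..n. g j x)" for n
    by (intro Lp_norm_cong_AE AE_S borel_measurable_sum fm gm) auto
  have AE_Q: "AE x in M. pair_sum n (\<lambda>j. f j x) = pair_sum n (\<lambda>j. g j x)" for n
    using fg by eventually_elim (auto simp: pair_sum_def intro!: sum.cong)
  have norm_Q: "Lp_norm M (p / 2) (\<lambda>x. \<Sum>(i, j)\<in>{(i, j). 1 \<le> i \<and> i < j \<and> j \<le> n}. f i x * f j x)
      = Lp_norm M (p / 2) (\<lambda>x. pair_sum n (\<lambda>j. g j x))" for n
    unfolding pair_sum_def[symmetric]
    by (intro Lp_norm_cong_AE AE_Q borel_measurable_pair_sum fm gm) auto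
  have nz: "\<not> (AE x in M. (\<Sum>j=1..n. g j x) = 0)" if "\<not> (AE x in M. (\<Sum>j=1..n. f j x) = 0)" for n
  proof
    assume "AE x in M. (\<Sum>j=1..n. g j x) = 0"
    with AE_S[of n] have "AE x in M. (\<Sum>j=1..n. f j x) = 0" by eventually_elim simp
    with that show False by simp
  qed
  show ?thesis
    unfolding norm_f norm_S norm_Q midpoint_const_def[symmetric]
    by (intro conjI impI allI Lp_sum_upper Lp_sum_lower gLp gnn nz) auto
qed

end
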